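(* The Lie algebra $\widehat{\mathfrak{sv}}$ defined in the context is the universal covering algebra (universal central extension) of the extended Schrödinger-Virasoro algebra $\widetilde{\mathfrak{sv}}$.
   Context: The extended Schrödinger-Virasoro Lie algebra $\widetilde{\mathfrak{sv}}$ is the complex Lie algebra with basis $\{L_n, M_n, N_n, Y_{n+\frac12} \mid n\in\mathbb{Z}\}$ and brackets, for all $m,n\in\mathbb{Z}$: $[L_m,L_n]=(n-m)L_{m+n}$, $[M_m,M_n]=0$, $[N_m,N_n]=0$, $[Y_{m+\frac12},Y_{n+\frac12}]=(m-n)M_{m+n+1}$, $[L_m,M_n]=nM_{m+n}$, $[L_m,N_n]=nN_{m+n}$, $[L_m,Y_{n+\frac12}]=\left(n+\frac{1-m}{2}\right)Y_{m+n+\frac12}$, $[N_m,M_n]=2M_{m+n}$, $[N_m,Y_{n+\frac12}]=Y_{m+n+\frac12}$, $[M_m,Y_{n+\frac12}]=0$. $\widehat{\mathfrak{sv}}=\widetilde{\mathfrak{sv}}\oplus\mathbb{C}C_L\oplus\mathbb{C}C_{LN}\oplus\mathbb{C}C_N$ as a vector space, with basis $\{L_n,M_n,N_n,Y_{n+\frac12},C_L,C_{LN},C_N\mid n\in\mathbb{Z}\}$ and brackets, for all $m,n\in\mathbb{Z}$: $[L_m,L_n]=(n-m)L_{m+n}+\delta_{m+n,0}\frac{m^3-m}{12}C_L$, $[N_m,N_n]=n\delta_{m+n,0}C_N$, $[L_m,N_n]=nN_{m+n}+\delta_{m+n,0}(m^2-m)C_{LN}$, $[M_m,M_n]=0$,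 $[Y_{m+\frac12},Y_{n+\frac12}]=(m-n)M_{m+n+1}$, $[L_m,M_n]=nM_{m+n}$, $[L_m,Y_{n+\frac12}]=\left(n+\frac{1-m}{2}\right)Y_{m+n+\frac12}$, $[N_m,M_n]=2M_{m+n}$, $[N_m,Y_{n+\frac12}]=Y_{m+n+\frac12}$, $[M_m,Y_{n+\frac12}]=0$, and $C_L,C_{LN},C_N$ central. The covering map $\widehat{\mathfrak{sv}}\to\widetilde{\mathfrak{sv}}$ is the projection along $\mathbb{C}C_L\oplus\mathbb{C}C_{LN}\oplus\mathbb{C}C_N$. For a perfect Lie algebra $\mathfrak{g}$ (i.e. $[\mathfrak{g},\mathfrak{g}]=\mathfrak{g}$), a central extension is a pair $(\widehat{\mathfrak{g}},\pi)$ with $\pi:\widehat{\mathfrak{g}}\to\mathfrak{g}$ a surjective homomorphism whose kernel lies in the center of $\widehat{\mathfrak{g}}$; it is a covering if $\widehat{\mathfrak{g}}$ is perfect. A covering $(\widehat{\mathfrak{g}},\pi)$ is a universal central extension if for every central extension $(\widehat{\mathfrak{g}}',\varphi)$ of $\mathfrak{g}$ there is a unique homomorphism $\psi:\widehat{\mathfrak{g}}\to\widehat{\mathfrak{g}}'$ with $\varphi\psi=\pi$; $\widehat{\mathfrak{g}}$ is then called the universal covering algebra of $\mathfrak{g}$. *)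

theory Defs
  imports Complex_Main "HOL-Library.Poly_Mapping"
begin

section \<open>Lie algebras and central extensions\<close>

locale lie_algebra = vector_space scale
  for scale :: "'k::field \<Rightarrow> 'a::ab_group_add \<Rightarrow> 'a" +
  fixes bracket :: "'a \<Rightarrow> 'a \<Rightarrow> 'a"
  assumes linear_left: "Vector_Spaces.linear scale scale (\<lambda>x. bracket x y)"
    and linear_right: "Vector_Spaces.linear scale scale (\<lambda>y. bracket x y)"
    and alternating: "bracket x x = 0"
    and jacobi: "bracket x (bracket y z) + bracket y (bracket z x) + bracket z (bracket x y) = 0"
begin

definition center :: "'a set" where
  "center = {z. \<forall>x. bracket z x = 0}"

definition derived :: "'a set" where
  "derived = span {bracket x y | x y. True}"

end

locale perfect_lie_algebra = lie_algebra +
  assumes perfect: "derived = UNIV"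

locale lie_hom =
  dom: lie_algebra scale1 bracket1 +
  cod: lie_algebra scale2 bracket2 +
  Vector_Spaces.linear scale1 scale2 f
  for scale1 :: "'k::field \<Rightarrow> 'a::ab_group_add \<Rightarrow> 'a" and bracket1
    and scale2 :: "'k \<Rightarrow> 'b::ab_group_add \<Rightarrow> 'b" and bracket2
    and f :: "'a \<Rightarrow> 'b" +
  assumes bracket_hom: "f (bracket1 x y) = bracket2 (f x) (f y)"

text \<open>The first algebra is the extension, the second one the perfect base algebra.\<close>

locale central_extension =
  lie_hom scale1 bracket1 scale2 bracket2 \<pi> +
  base: perfect_lie_algebra scale2 bracket2
  for scale1 :: "'k::field \<Rightarrow> 'a::ab_group_add \<Rightarrow> 'a" and bracket1
    and scale2 :: "'k \<Rightarrow> 'b::ab_group_add \<Rightarrow> 'b" and bracket2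
    and \<pi> :: "'a \<Rightarrow> 'b" +
  assumes surjective: "surj \<pi>"
    and kernel_central: "{x. \<pi> x = 0} \<subseteq> dom.center"

locale covering =
  central_extension scale1 bracket1 scale2 bracket2 \<pi> +
  cover: perfect_lie_algebra scale1 bracket1
  for scale1 :: "'k::field \<Rightarrow> 'a::ab_group_add \<Rightarrow> 'a" and bracket1
    and scale2 :: "'k \<Rightarrow> 'b::ab_group_add \<Rightarrow> 'b" and bracket2
    and \<pi> :: "'a \<Rightarrow> 'b"

text \<open>
  A formula of HOL cannot quantify over types, so the type \<open>'c\<close> on which the competing
  central extensions live is a parameter. With \<open>'c\<close> left free in a theorem, the universal
  property is asserted for all central extensions.
\<close>

definition universal_central_extension ::
  "'c::ab_group_add itself \<Rightarrow>
   ('k::field \<Rightarrow> 'a::ab_group_add \<Rightarrow> 'a) \<Rightarrow> ('a \<Rightarrow> 'a \<Rightarrow> 'a) \<Rightarrow>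
   ('k \<Rightarrow> 'b::ab_group_add \<Rightarrow> 'b) \<Rightarrow> ('b \<Rightarrow> 'b \<Rightarrow> 'b) \<Rightarrow> ('a \<Rightarrow> 'b) \<Rightarrow> bool" where
  "universal_central_extension _ scale1 bracket1 scale2 bracket2 \<pi> \<longleftrightarrow>
     covering scale1 bracket1 scale2 bracket2 \<pi> \<and>
     (\<forall>(scale' :: 'k \<Rightarrow> 'c \<Rightarrow> 'c) bracket' \<phi>.
        central_extension scale' bracket' scale2 bracket2 \<phi> \<longrightarrow>
        (\<exists>!\<psi>. lie_hom scale1 bracket1 scale' bracket' \<psi> \<and> \<phi> \<circ> \<psi> = \<pi>))"


section \<open>Algebras given by structure constants\<close>

text \<open>
  The space with basis \<open>'i\<close> is the type of finitely supported functions
  \<open>'i \<Rightarrow>\<^sub>0 'k\<close>; the basis vector at \<open>i\<close> is \<open>Poly_Mapping.single i 1\<close>.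
\<close>

definition pscale :: "'k::field \<Rightarrow> ('i \<Rightarrow>\<^sub>0 'k) \<Rightarrow> ('i \<Rightarrow>\<^sub>0 'k)" where
  "pscale c f = Poly_Mapping.map ((*) c) f"

definition bilinear_extension ::
  "('i \<Rightarrow> 'i \<Rightarrow> ('i \<Rightarrow>\<^sub>0 'k::field)) \<Rightarrow> ('i \<Rightarrow>\<^sub>0 'k) \<Rightarrow> ('i \<Rightarrow>\<^sub>0 'k) \<Rightarrow> ('i \<Rightarrow>\<^sub>0 'k)" where
  "bilinear_extension b f g =
     (\<Sum>i\<in>Poly_Mapping.keys f. \<Sum>j\<in>Poly_Mapping.keys g.
        pscale (Poly_Mapping.lookup f i * Poly_Mapping.lookup g j) (b i j))"


section \<open>The extended Schroedinger-Virasoro algebra\<close>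

text \<open>\<open>Y n\<close> is the index of the basis vector \<open>Y\<close> with subscript \<open>n + 1/2\<close>.\<close>

datatype sv_index = L int | M int | N int | Y int

type_synonym sv = "sv_index \<Rightarrow>\<^sub>0 complex"

fun sv_basis_bracket :: "sv_index \<Rightarrow> sv_index \<Rightarrow> sv" where
  "sv_basis_bracket (L m) (L n) = Poly_Mapping.single (L (m + n)) (of_int (n - m))"
| "sv_basis_bracket (M m) (M n) = 0"
| "sv_basis_bracket (N m) (N n) = 0"
| "sv_basis_bracket (Y m) (Y n) = Poly_Mapping.single (M (m + n + 1)) (of_int (m - n))"
| "sv_basis_bracket (L m) (M n) = Poly_Mapping.single (M (m + n)) (of_int n)"
| "sv_basis_bracket (M n) (L m) = - Poly_Mapping.single (M (m + n)) (of_int n)"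
| "sv_basis_bracket (L m) (N n) = Poly_Mapping.single (N (m + n)) (of_int n)"
| "sv_basis_bracket (N n) (L m) = - Poly_Mapping.single (N (m + n)) (of_int n)"
| "sv_basis_bracket (L m) (Y n) = Poly_Mapping.single (Y (m + n)) (of_int n + (1 - of_int m) / 2)"
| "sv_basis_bracket (Y n) (L m) = - Poly_Mapping.single (Y (m + n)) (of_int n + (1 - of_int m) / 2)"
| "sv_basis_bracket (N m) (M n) = Poly_Mapping.single (M (m + n)) 2"
| "sv_basis_bracket (M n) (N m) = - Poly_Mapping.single (M (m + n)) 2"
| "sv_basis_bracket (N m) (Y n) = Poly_Mapping.single (Y (m + n)) 1"
| "sv_basis_bracket (Y n) (N m) = - Poly_Mapping.single (Y (m + n)) 1"
| "sv_basis_bracket (M m) (Y n) = 0"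
| "sv_basis_bracket (Y n) (M m) = 0"

definition sv_bracket :: "sv \<Rightarrow> sv \<Rightarrow> sv" where
  "sv_bracket = bilinear_extension sv_basis_bracket"


section \<open>Its covering algebra\<close>

text \<open>\<open>Lift\<close> marks the indices that are shared with the extended algebra.\<close>

datatype sv_hat_index = Lift sv_index | C_L | C_LN | C_N

type_synonym sv_hat = "sv_hat_index \<Rightarrow>\<^sub>0 complex"

fun sv_hat_basis_bracket :: "sv_hat_index \<Rightarrow> sv_hat_index \<Rightarrow> sv_hat" where
  "sv_hat_basis_bracket (Lift (L m)) (Lift (L n)) =
     Poly_Mapping.single (Lift (L (m + n))) (of_int (n - m)) +
     (if m + n = 0 then Poly_Mapping.single C_L ((of_int m ^ 3 - of_int m) / 12) else 0)"
| "sv_hat_basis_bracket (Lift (M m)) (Lift (M n)) = 0"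
| "sv_hat_basis_bracket (Lift (N m)) (Lift (N n)) =
     (if m + n = 0 then Poly_Mapping.single C_N (of_int n) else 0)"
| "sv_hat_basis_bracket (Lift (Y m)) (Lift (Y n)) =
     Poly_Mapping.single (Lift (M (m + n + 1))) (of_int (m - n))"
| "sv_hat_basis_bracket (Lift (L m)) (Lift (M n)) =
     Poly_Mapping.single (Lift (M (m + n))) (of_int n)"
| "sv_hat_basis_bracket (Lift (M n)) (Lift (L m)) =
     - Poly_Mapping.single (Lift (M (m + n))) (of_int n)"
| "sv_hat_basis_bracket (Lift (L m)) (Lift (N n)) =
     Poly_Mapping.single (Lift (N (m + n))) (of_int n) +
     (if m + n = 0 then Poly_Mapping.single C_LN (of_int (m ^ 2 - m)) else 0)"
| "sv_hat_basis_bracket (Lift (N n)) (Lift (L m)) =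
     - (Poly_Mapping.single (Lift (N (m + n))) (of_int n) +
        (if m + n = 0 then Poly_Mapping.single C_LN (of_int (m ^ 2 - m)) else 0))"
| "sv_hat_basis_bracket (Lift (L m)) (Lift (Y n)) =
     Poly_Mapping.single (Lift (Y (m + n))) (of_int n + (1 - of_int m) / 2)"
| "sv_hat_basis_bracket (Lift (Y n)) (Lift (L m)) =
     - Poly_Mapping.single (Lift (Y (m + n))) (of_int n + (1 - of_int m) / 2)"
| "sv_hat_basis_bracket (Lift (N m)) (Lift (M n)) =
     Poly_Mapping.single (Lift (M (m + n))) 2"
| "sv_hat_basis_bracket (Lift (M n)) (Lift (N m)) =
     - Poly_Mapping.single (Lift (M (m + n))) 2"
| "sv_hat_basis_bracket (Lift (N m)) (Lift (Y n)) =
     Poly_Mapping.single (Lift (Y (m + n))) 1"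
| "sv_hat_basis_bracket (Lift (Y n)) (Lift (N m)) =
     - Poly_Mapping.single (Lift (Y (m + n))) 1"
| "sv_hat_basis_bracket (Lift (M m)) (Lift (Y n)) = 0"
| "sv_hat_basis_bracket (Lift (Y n)) (Lift (M m)) = 0"
| "sv_hat_basis_bracket C_L _ = 0"
| "sv_hat_basis_bracket C_LN _ = 0"
| "sv_hat_basis_bracket C_N _ = 0"
| "sv_hat_basis_bracket (Lift _) C_L = 0"
| "sv_hat_basis_bracket (Lift _) C_LN = 0"
| "sv_hat_basis_bracket (Lift _) C_N = 0"

definition sv_hat_bracket :: "sv_hat \<Rightarrow> sv_hat \<Rightarrow> sv_hat" where
  "sv_hat_bracket = bilinear_extension sv_hat_basis_bracket"

text \<open>The projection along the span of \<open>C_L\<close>, \<open>C_LN\<close> and \<open>C_N\<close>: it restricts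
  a coefficient function to the indices of the form \<open>Lift i\<close>.\<close>

definition sv_projection :: "sv_hat \<Rightarrow> sv" where
  "sv_projection = Poly_Mapping.map_key Lift"

end

theory Submission
  imports Defs
begin

text \<open>
  Let \<open>\<phi>\<close> be a central extension. The bracket of lifts along \<open>\<phi>\<close> does not depend on the lifts, so it is
  a cocycle on the extended algebra with values in the total space. Homomorphisms over the base
  into this space are the same as factorizations of the cocycle through the bracket of the
  covering algebra. Such a factorization is linear algebra on the basis: the weights of \<open>N 0\<close> and
  \<open>L 0\<close> determine the cocycle except on the pairs \<open>(L m, L (- m))\<close>, \<open>(L m, N (- m))\<close> and
  \<open>(N m, N (- m))\<close>, and there the cocycle identity is a recursion in \<open>m\<close> whose solutions are
  combinations of the structure constants of \<open>L 0\<close>, \<open>N 0\<close> and the three central elements.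
\<close>

section \<open>Linear algebra\<close>

text \<open>A nonzero vector is independent, so the value 1 at it extends to a linear functional.
  Vector identities can thus be tested on scalars.\<close>

lemma (in vector_space) separating_functional:
  assumes "v \<noteq> 0"
  obtains f where "Vector_Spaces.linear scale (*) f" "f v \<noteq> 0"
proof -
  interpret field: vector_space "(*) :: 'a \<Rightarrow> 'a \<Rightarrow> 'a"
    by unfold_locales (simp_all add: algebra_simps)
  interpret vector_space_pair scale "(*) :: 'a \<Rightarrow> 'a \<Rightarrow> 'a"
    by unfold_locales
  have "independent {v}"
    using assms by simp
  from linear_independent_extend[OF this, of "\<lambda>_. 1"] show ?thesis
    using that by auto
qed

lemma lookup_pscale [simp]:
  "Poly_Mapping.lookup (pscale c f) i = c * Poly_Mapping.lookup f i"
  by (auto simp: pscale_def Poly_Mapping.map.rep_eq when_def)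

lemma pscale_single [simp]: "pscale c (Poly_Mapping.single i d) = Poly_Mapping.single i (c * d)"
  by (rule poly_mapping_eqI) (simp add: lookup_single when_def)

interpretation pscale: vector_space pscale
  by unfold_locales (auto intro!: poly_mapping_eqI simp: lookup_add algebra_simps)

lemma poly_mapping_expansion:
  "f = (\<Sum>i\<in>Poly_Mapping.keys f. pscale (Poly_Mapping.lookup f i) (Poly_Mapping.single i 1))"
  by (rule poly_mapping_eqI)
    (auto simp: lookup_sum lookup_single when_def in_keys_iff sum.delta intro: sym)

lemma linear_eq_on_basis:
  assumes "Vector_Spaces.linear pscale s f" "Vector_Spaces.linear pscale s g"
    and "\<And>i. f (Poly_Mapping.single i 1) = g (Poly_Mapping.single i 1)"
  shows "f x = g x"
proof -
  interpret f: Vector_Spaces.linear pscale s f by fact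
  interpret g: Vector_Spaces.linear pscale s g by fact
  show ?thesis
    by (subst (1 2) poly_mapping_expansion)
      (simp add: f.sum g.sum f.scale g.scale assms(3) del: pscale_single)
qed

definition linear_extension ::
  "('k::field \<Rightarrow> 'v::ab_group_add \<Rightarrow> 'v) \<Rightarrow> ('i \<Rightarrow> 'v) \<Rightarrow> ('i \<Rightarrow>\<^sub>0 'k) \<Rightarrow> 'v" where
  "linear_extension s \<phi> f = (\<Sum>i\<in>Poly_Mapping.keys f. s (Poly_Mapping.lookup f i) (\<phi> i))"

context vector_space
begin

text \<open>Combinations with different supports become comparable over one finite set, as
  coefficients off the support vanish.\<close>

lemma linear_extension_superset:
  assumes "finite A" "Poly_Mapping.keys f \<subseteq> A"
  shows "linear_extension scale \<phi> f = (\<Sum>i\<in>A. scale (Poly_Mapping.lookup f i) (\<phi> i))"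
  unfolding linear_extension_def
  using assms by (intro sum.mono_neutral_left) (auto simp: in_keys_iff)

lemma linear_linear_extension: "Vector_Spaces.linear pscale scale (linear_extension scale \<phi>)"
proof (unfold Vector_Spaces.linear_iff, intro conjI allI)
  fix f g :: "'c \<Rightarrow>\<^sub>0 'a" and c
  let ?A = "Poly_Mapping.keys f \<union> Poly_Mapping.keys g"
  have "Poly_Mapping.keys (f + g) \<subseteq> ?A"
    by (rule keys_add)
  then show "linear_extension scale \<phi> (f + g) =
      linear_extension scale \<phi> f + linear_extension scale \<phi> g"
    by (simp add: linear_extension_superset[where A = ?A] lookup_add scale_left_distrib sum.distrib)
  have "Poly_Mapping.keys (pscale c f) \<subseteq> Poly_Mapping.keys f"
    by (auto simp: in_keys_iff)
  then show "linear_extension scale \<phi> (pscale c f) = scale c (linear_extension scale \<phi> f)"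
    by (simp add: linear_extension_superset[where A = "Poly_Mapping.keys f"] scale_sum_right)
qed (unfold_locales)

lemma linear_extension_single [simp]:
  "linear_extension scale \<phi> (Poly_Mapping.single i c) = scale c (\<phi> i)"
  by (simp add: linear_extension_def)

lemma linear_extension_zero [simp]: "linear_extension scale \<phi> 0 = 0"
  by (simp add: linear_extension_def)

lemma linear_extension_add [simp]:
  "linear_extension scale \<phi> (f + g) = linear_extension scale \<phi> f + linear_extension scale \<phi> g"
  using linear_linear_extension by (auto simp: Vector_Spaces.linear_iff)

lemma linear_extension_uminus [simp]:
  "linear_extension scale \<phi> (- f) = - linear_extension scale \<phi> f"
proof -
  interpret Vector_Spaces.linear pscale scale "linear_extension scale \<phi>"
    by (rule linear_linear_extension)
  show ?thesis by (rule neg)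
qed

end

lemma linear_comp_linear_extension:
  assumes "Vector_Spaces.linear s t h"
  shows "h (linear_extension s \<phi> f) = linear_extension t (\<lambda>i. h (\<phi> i)) f"
proof -
  interpret h: Vector_Spaces.linear s t h by fact
  show ?thesis
    by (simp add: linear_extension_def h.sum h.scale)
qed

lemma linear_eq_linear_extension:
  assumes "Vector_Spaces.linear pscale s h"
  shows "h f = linear_extension s (\<lambda>i. h (Poly_Mapping.single i 1)) f"
proof -
  interpret h: Vector_Spaces.linear pscale s h by fact
  show ?thesis
    by (rule linear_eq_on_basis[OF assms h.vs2.linear_linear_extension]) simp
qed

section \<open>Bilinear maps from structure constants\<close>

lemma bilinear_extension_eq_left:
  "bilinear_extension b f g = linear_extension pscale (\<lambda>i. linear_extension pscale (b i) g) f"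
  by (simp add: bilinear_extension_def linear_extension_def pscale.scale_sum_right)

text \<open>Summing in the other order exhibits linearity in the second argument.\<close>

lemma bilinear_extension_eq_right:
  "bilinear_extension b f g = linear_extension pscale (\<lambda>j. linear_extension pscale (\<lambda>i. b i j) f) g"
  unfolding bilinear_extension_def
  by (subst sum.swap) (simp add: linear_extension_def pscale.scale_sum_right mult.commute)

lemma bilinear_extension_linear_left:
  "Vector_Spaces.linear pscale pscale (\<lambda>f. bilinear_extension b f g)"
  unfolding bilinear_extension_eq_left by (rule pscale.linear_linear_extension)

lemma bilinear_extension_linear_right:
  "Vector_Spaces.linear pscale pscale (\<lambda>g. bilinear_extension b f g)"
  unfolding bilinear_extension_eq_right by (rule pscale.linear_linear_extension)

lemma bilinear_extension_single [simp]:
  "bilinear_extension b (Poly_Mapping.single i c) (Poly_Mapping.single j d) = pscale (c * d) (b i j)"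
  by (simp add: bilinear_extension_eq_left)

lemma bilinear_eq_on_basis:
  assumes "\<And>y. Vector_Spaces.linear pscale s (\<lambda>x. f x y)" "\<And>x. Vector_Spaces.linear pscale s (f x)"
    and "\<And>y. Vector_Spaces.linear pscale s (\<lambda>x. g x y)" "\<And>x. Vector_Spaces.linear pscale s (g x)"
    and "\<And>i j. f (Poly_Mapping.single i 1) (Poly_Mapping.single j 1) =
      g (Poly_Mapping.single i 1) (Poly_Mapping.single j 1)"
  shows "f x y = g x y"
proof -
  have "f x (Poly_Mapping.single j 1) = g x (Poly_Mapping.single j 1)" for j
    by (rule linear_eq_on_basis[OF assms(1,3,5)])
  then show ?thesis
    by (rule linear_eq_on_basis[OF assms(2,4)])
qed

lemma linear_add3:
  assumes f: "Vector_Spaces.linear s t f" and g: "Vector_Spaces.linear s t g"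
    and h: "Vector_Spaces.linear s t h"
  shows "Vector_Spaces.linear s t (\<lambda>x. f x + g x + h x)"
proof -
  interpret f: Vector_Spaces.linear s t f by fact
  interpret module_pair s t by unfold_locales
  show ?thesis
    using f g h by (simp only: linear_iff_module_hom module_hom_add)
qed

text \<open>Antisymmetry and the Jacobi identity are multilinear, so they pass from basis vectors to
  all vectors; the alternating law is quadratic and is derived from antisymmetry.\<close>

lemma lie_algebra_bilinear_extension:
  fixes b :: "'i \<Rightarrow> 'i \<Rightarrow> ('i \<Rightarrow>\<^sub>0 'k::field_char_0)"
  assumes anti: "\<And>i j. b j i = - b i j"
    and jac: "\<And>i j k. linear_extension pscale (b i) (b j k) +
      linear_extension pscale (b j) (b k i) + linear_extension pscale (b k) (b i j) = 0"
  shows "lie_algebra pscale (bilinear_extension b)"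
proof -
  let ?B = "bilinear_extension b"
  note lin = bilinear_extension_linear_left[of b] bilinear_extension_linear_right[of b]
  have lin': "Vector_Spaces.linear pscale pscale (\<lambda>x. - f x)"
    if "Vector_Spaces.linear pscale pscale f" for f :: "('i \<Rightarrow>\<^sub>0 'k) \<Rightarrow> ('i \<Rightarrow>\<^sub>0 'k)"
    using that by (simp add: Vector_Spaces.linear_iff)
  have antisym: "?B x y = - ?B y x" for x y
    by (rule bilinear_eq_on_basis[where s = pscale]) (auto intro!: lin lin' simp: anti[symmetric])
  have alt: "?B x x = 0" for x
  proof (rule poly_mapping_eqI)
    fix i
    define a where "a = Poly_Mapping.lookup (?B x x) i"
    \<comment> \<open>In characteristic 0 a coefficient equal to its own negative is zero.\<close>
    have "a = - a"
      unfolding a_def lookup_uminus[symmetric] by (subst antisym) (rule refl)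
    then have "2 * a = 0"
      by (metis add.right_inverse mult_2)
    then show "Poly_Mapping.lookup (?B x x) i = Poly_Mapping.lookup 0 i"
      by (simp add: a_def)
  qed
  have comp: "Vector_Spaces.linear pscale pscale (\<lambda>x. ?B u (?B v x))"
    "Vector_Spaces.linear pscale pscale (\<lambda>x. ?B u (?B x v))" for u v
    using Vector_Spaces.linear_compose[OF lin(2) lin(2)]
      Vector_Spaces.linear_compose[OF lin(1) lin(2)]
    by (auto simp: o_def)
  let ?J = "\<lambda>x y z. ?B x (?B y z) + ?B y (?B z x) + ?B z (?B x y)"
  have zero: "Vector_Spaces.linear pscale pscale (\<lambda>_. 0 :: 'i \<Rightarrow>\<^sub>0 'k)"
    by (simp add: Vector_Spaces.linear_iff pscale.vector_space_axioms)
  have basis: "?J (Poly_Mapping.single i 1) (Poly_Mapping.single j 1) (Poly_Mapping.single k 1) = 0"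
    for i j k
    using jac[of i j k] by (simp add: bilinear_extension_eq_left)
  have lin3: "Vector_Spaces.linear pscale pscale (\<lambda>u. ?J u v w)"
    "Vector_Spaces.linear pscale pscale (\<lambda>u. ?J v u w)"
    "Vector_Spaces.linear pscale pscale (\<lambda>u. ?J v w u)" for v w
    by (rule linear_add3; (rule comp | rule lin))+
  \<comment> \<open>The cyclic sum is linear in each argument, so the arguments are freed from the
    basis one after another.\<close>
  have basis2: "?J x (Poly_Mapping.single j 1) (Poly_Mapping.single k 1) = 0" for x j k
    by (rule linear_eq_on_basis[OF lin3(1) zero, OF basis])
  have basis1: "?J x y (Poly_Mapping.single k 1) = 0" for x y k
    by (rule linear_eq_on_basis[OF lin3(2) zero, OF basis2])
  have jacobi: "?J x y z = 0" for x y z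
    by (rule linear_eq_on_basis[OF lin3(3) zero, OF basis1])
  show ?thesis
    by (rule lie_algebra.intro[OF pscale.vector_space_axioms lie_algebra_axioms.intro])
      (rule lin alt jacobi)+
qed

section \<open>Central extensions and cocycles\<close>

lemma (in lie_algebra) antisym: "bracket x y = - bracket y x"
proof -
  interpret l: Vector_Spaces.linear scale scale "\<lambda>x. bracket x v" for v by (rule linear_left)
  interpret r: Vector_Spaces.linear scale scale "\<lambda>x. bracket v x" for v by (rule linear_right)
  have "bracket (x + y) (x + y) = 0"
    by (rule alternating)
  then have "bracket x y + bracket y x = 0"
    by (simp only: l.add r.add) (simp add: alternating add.commute)
  then show ?thesis
    by (simp only: eq_neg_iff_add_eq_0)
qed

lemma (in lie_hom) image_derived: "f ` dom.derived \<subseteq> cod.derived"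
proof -
  have "f ` dom.derived = cod.span (f ` {bracket1 x y |x y. True})"
    unfolding dom.derived_def by (rule span_image[symmetric])
  also have "\<dots> \<subseteq> cod.derived"
    unfolding cod.derived_def by (rule cod.span_mono) (auto simp: bracket_hom, blast)
  finally show ?thesis .
qed

lemma (in lie_hom) perfect_image:
  assumes "dom.derived = UNIV" "surj f"
  shows "cod.derived = UNIV"
  using image_derived assms by auto

section \<open>The cocycle of a central extension\<close>

context central_extension
begin

text \<open>Two lifts of one element differ by an element of the kernel, which is central and drops
  out of brackets.\<close>

lemma bracket1_cong:
  assumes "\<pi> a = \<pi> a'" "\<pi> b = \<pi> b'"
  shows "bracket1 a b = bracket1 a' b'"
proof -
  interpret l: Vector_Spaces.linear scale1 scale1 "\<lambda>x. bracket1 x v" for v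
    by (rule dom.linear_left)
  have *: "bracket1 c d = bracket1 c' d" if "\<pi> c = \<pi> c'" for c c' d
  proof -
    have "c - c' \<in> dom.center"
      using that kernel_central by (auto simp: diff)
    then have "bracket1 (c - c') d = 0"
      by (simp add: dom.center_def)
    then show ?thesis
      by (simp add: l.diff)
  qed
  \<comment> \<open>\<open>center\<close> speaks of the left argument; antisymmetry handles the
    right one.\<close>
  show ?thesis
    using *[OF assms(1), of b] *[OF assms(2), of a'] dom.antisym by metis
qed

text \<open>\<open>inv \<pi>\<close> is an arbitrary set-theoretic section, in general not linear;
  by \<open>bracket1_cong\<close> the choice does not affect the value.\<close>

definition lifted_bracket :: "'b \<Rightarrow> 'b \<Rightarrow> 'a" where
  "lifted_bracket x y = bracket1 (inv \<pi> x) (inv \<pi> y)"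

lemma lifted_bracket_image [simp]: "lifted_bracket (\<pi> a) (\<pi> b) = bracket1 a b"
  unfolding lifted_bracket_def by (rule bracket1_cong) (simp_all add: surjective surj_f_inv_f)

lemma image_lifted_bracket [simp]: "\<pi> (lifted_bracket x y) = bracket2 x y"
  by (simp add: lifted_bracket_def bracket_hom surjective surj_f_inv_f)

text \<open>Sums and multiples of lifts are lifts of sums and multiples.\<close>

lemma lifted_bracket_linear_left:
  "Vector_Spaces.linear scale2 scale1 (\<lambda>x. lifted_bracket x y)"
proof -
  interpret l: Vector_Spaces.linear scale1 scale1 "\<lambda>x. bracket1 x v" for v
    by (rule dom.linear_left)
  obtain c where y: "y = \<pi> c" using surjective by blast
  show ?thesis
  proof (unfold Vector_Spaces.linear_iff, intro conjI allI)
    fix u v r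
    obtain a b where ab: "u = \<pi> a" "v = \<pi> b" using surjective by blast
    show "lifted_bracket (u + v) y = lifted_bracket u y + lifted_bracket v y"
      unfolding ab y add[symmetric] lifted_bracket_image by (rule l.add)
    show "lifted_bracket (scale2 r u) y = scale1 r (lifted_bracket u y)"
      unfolding ab y scale[symmetric] lifted_bracket_image by (rule l.scale)
  qed unfold_locales
qed

lemma lifted_bracket_antisym: "lifted_bracket x y = - lifted_bracket y x"
  unfolding lifted_bracket_def by (rule dom.antisym)

text \<open>Brackets of lifts are lifts of brackets, so this is the Jacobi identity of the total
  space.\<close>

lemma lifted_bracket_cocycle:
  "lifted_bracket x (bracket2 y z) + lifted_bracket y (bracket2 z x) +
    lifted_bracket z (bracket2 x y) = 0"
proof -
  obtain a b c where "x = \<pi> a" "y = \<pi> b" "z = \<pi> c" using surjective by blast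
  then show ?thesis
    using dom.jacobi[of a b c] by (simp add: bracket_hom[symmetric])
qed

end

text \<open>The images of \<open>y\<close> and \<open>z\<close> under the two maps lie over the same
  elements, so both maps agree on \<open>b1 y z\<close>; by perfectness such brackets span.\<close>

lemma lie_hom_into_central_extension_unique:
  assumes "perfect_lie_algebra s1 b1" "central_extension s b s2 b2 \<phi>"
    and "lie_hom s1 b1 s b \<psi>" "lie_hom s1 b1 s b \<chi>" "\<phi> \<circ> \<psi> = \<phi> \<circ> \<chi>"
  shows "\<psi> = \<chi>"
proof
  fix x
  interpret perfect_lie_algebra s1 b1 by fact
  interpret central_extension s b s2 b2 \<phi> by fact
  interpret p: lie_hom s1 b1 s b \<psi> by fact
  interpret c: lie_hom s1 b1 s b \<chi> by fact
  interpret pair: module_pair s1 s by unfold_locales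
  have "\<psi> u = \<chi> u" if u: "u \<in> {b1 y z | y z. True}" for u
  proof -
    obtain y z where "u = b1 y z" using u by blast
    then show ?thesis
      using assms(5) by (auto simp: p.bracket_hom c.bracket_hom fun_eq_iff intro!: bracket1_cong)
  qed
  moreover have "x \<in> span {b1 y z | y z. True}"
    using perfect by (simp add: derived_def)
  ultimately show "\<psi> x = \<chi> x"
    using pair.module_hom_eq_on_span p.module_hom_axioms c.module_hom_axioms by blast
qed

text \<open>Linearity and the factorization suffice: \<open>\<phi> \<circ> \<psi>\<close> and
  \<open>\<pi>\<close> agree on brackets, hence everywhere by perfectness.\<close>

lemma lie_hom_of_factored_bracket:
  assumes "perfect_lie_algebra s1 b1" "lie_hom s1 b1 s2 b2 \<pi>" "central_extension s b s2 b2 \<phi>"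
    and "Vector_Spaces.linear s1 s \<psi>"
    and fac: "\<And>x y. central_extension.lifted_bracket b \<phi> (\<pi> x) (\<pi> y) = \<psi> (b1 x y)"
  shows "lie_hom s1 b1 s b \<psi> \<and> \<phi> \<circ> \<psi> = \<pi>"
proof -
  interpret g: perfect_lie_algebra s1 b1 by fact
  interpret p: lie_hom s1 b1 s2 b2 \<pi> by fact
  interpret central_extension s b s2 b2 \<phi> by fact
  interpret psi: Vector_Spaces.linear s1 s \<psi> by fact
  interpret pair: module_pair s1 s2 by unfold_locales
  have brackets: "(\<phi> \<circ> \<psi>) u = \<pi> u" if "u \<in> {b1 y z | y z. True}" for u
    using that by (auto simp: fac[symmetric] p.bracket_hom)
  have "module_hom s1 s2 (\<phi> \<circ> \<psi>)"
    by (rule module_hom_compose) unfold_locales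
  then have "(\<phi> \<circ> \<psi>) x = \<pi> x" for x
    using pair.module_hom_eq_on_span[OF _ p.module_hom_axioms brackets] g.perfect
    unfolding g.derived_def by blast
  then have comp: "\<phi> (\<psi> x) = \<pi> x" for x
    by simp
  \<comment> \<open>Now \<open>\<psi> x\<close> and \<open>\<psi> y\<close> are lifts of
    \<open>\<pi> x\<close> and \<open>\<pi> y\<close>, so the lifted bracket is their
    bracket.\<close>
  have "\<psi> (b1 x y) = b (\<psi> x) (\<psi> y)" for x y
    unfolding fac[symmetric] comp[symmetric] by simp
  then have "lie_hom s1 b1 s b \<psi>"
    by unfold_locales
  then show ?thesis
    using comp by auto
qed

section \<open>The covering algebra is a Lie algebra\<close>

text \<open>The Kronecker symbol replaces the conditionals in the structure constants, whose case splits
  would multiply in the Jacobi identity.\<close>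

definition delta0 :: "int \<Rightarrow> complex" where
  "delta0 n = (if n = 0 then 1 else 0)"

lemma delta0_simps [simp]: "delta0 0 = 1" "n \<noteq> 0 \<Longrightarrow> delta0 n = 0"
  by (simp_all add: delta0_def)

lemma linear_extension_fun_0 [simp]: "linear_extension pscale (\<lambda>_. 0) f = 0"
  by (simp add: linear_extension_def)

text \<open>As equations between functions these also rewrite partial applications inside
  \<open>linear_extension\<close>.\<close>

lemma sv_hat_basis_bracket_central_left [simp]:
  "sv_hat_basis_bracket C_L = (\<lambda>_. 0)"
  "sv_hat_basis_bracket C_LN = (\<lambda>_. 0)"
  "sv_hat_basis_bracket C_N = (\<lambda>_. 0)"
  by (simp_all add: fun_eq_iff)

lemma sv_hat_basis_bracket_central_right [simp]:
  "sv_hat_basis_bracket i C_L = 0" "sv_hat_basis_bracket i C_LN = 0" "sv_hat_basis_bracket i C_N = 0"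
  by (cases i; simp)+

lemma sv_hat_basis_bracket_delta0 [simp]:
  "sv_hat_basis_bracket (Lift (L m)) (Lift (L n)) =
     Poly_Mapping.single (Lift (L (m + n))) (of_int (n - m)) +
     Poly_Mapping.single C_L (delta0 (m + n) * (of_int m ^ 3 - of_int m) / 12)"
  "sv_hat_basis_bracket (Lift (N m)) (Lift (N n)) =
     Poly_Mapping.single C_N (delta0 (m + n) * of_int n)"
  "sv_hat_basis_bracket (Lift (L m)) (Lift (N n)) =
     Poly_Mapping.single (Lift (N (m + n))) (of_int n) +
     Poly_Mapping.single C_LN (delta0 (m + n) * of_int (m ^ 2 - m))"
  "sv_hat_basis_bracket (Lift (N n)) (Lift (L m)) =
     Poly_Mapping.single (Lift (N (m + n))) (- of_int n) +
     Poly_Mapping.single C_LN (delta0 (m + n) * of_int (m - m ^ 2))"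
  by (simp_all add: delta0_def single_uminus single_diff)

declare sv_hat_basis_bracket.simps(1,3,7,8) [simp del]

text \<open>Where \<open>delta0\<close> is nonzero, \<open>n = - m\<close>, and both
  \<open>m ^ 3 - m\<close> and \<open>m\<close> are odd in \<open>m\<close>.\<close>

lemma delta0_swap:
  "delta0 (n + m) * (of_int n ^ 3 - of_int n) = - (delta0 (m + n) * (of_int m ^ 3 - of_int m))"
  "delta0 (n + m) * of_int m = - (delta0 (m + n) * of_int n)"
proof -
  have *: "delta0 (m + n) = 0 \<or> n = - m"
    by (auto simp: delta0_def)
  show "delta0 (n + m) * (of_int n ^ 3 - of_int n) = - (delta0 (m + n) * (of_int m ^ 3 - of_int m))"
    using * unfolding add.commute[of n m] by (elim disjE) (simp_all add: right_diff_distrib)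
  show "delta0 (n + m) * of_int m = - (delta0 (m + n) * of_int n)"
    using * unfolding add.commute[of n m] by (elim disjE) simp_all
qed

lemma sv_hat_basis_bracket_antisym: "sv_hat_basis_bracket j i = - sv_hat_basis_bracket i j"
proof -
  let ?P = "\<lambda>i j. sv_hat_basis_bracket j i = - sv_hat_basis_bracket i j"
  have LL: "?P (Lift (L m)) (Lift (L n))" for m n
    unfolding sv_hat_basis_bracket_delta0 delta0_swap(1)[of n m]
    by (simp add: add.commute[of n m] single_uminus[symmetric])
  have NN: "?P (Lift (N m)) (Lift (N n))" for m n
    unfolding sv_hat_basis_bracket_delta0 delta0_swap(2)[of n m] by (rule single_uminus)
  have YY: "?P (Lift (Y m)) (Lift (Y n))" for m n
    by (simp add: add.commute[of n m] single_uminus[symmetric])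
  \<comment> \<open>In the original equations one order is literally the negative of the other; the
    \<open>delta0\<close> forms hide this.\<close>
  have LN: "?P (Lift (L m)) (Lift (N n))" "?P (Lift (N n)) (Lift (L m))" for m n
    by (simp_all only: sv_hat_basis_bracket.simps minus_minus)
  have lift: "?P (Lift u) (Lift v)" for u v
    by (cases u; cases v; hypsubst; (rule LL NN YY LN | simp))
  show ?thesis
    by (cases i; cases j; hypsubst; (rule lift | simp))
qed

section \<open>The Jacobi identity on basis vectors\<close>

definition jacobiator :: "sv_index \<Rightarrow> sv_index \<Rightarrow> sv_index \<Rightarrow> sv_hat" where
  "jacobiator i j k =
     linear_extension pscale (sv_hat_basis_bracket (Lift i)) (sv_hat_basis_bracket (Lift j) (Lift k)) +
     linear_extension pscale (sv_hat_basis_bracket (Lift j)) (sv_hat_basis_bracket (Lift k) (Lift i)) +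
     linear_extension pscale (sv_hat_basis_bracket (Lift k)) (sv_hat_basis_bracket (Lift i) (Lift j))"

text \<open>Comparing coefficients yields identities guarded by equations between indices; this
  strips the guard and leaves a polynomial identity.\<close>

lemma drop_premise: "Q \<Longrightarrow> P \<longrightarrow> Q"
  by simp

text \<open>\<open>h\<close> names the constant 1/2, which the algebra method handles better as an atom.\<close>

context
  fixes a b c s :: int and h :: complex
  assumes s: "s = a + b + c" and h: "h = 1 / 2"
begin

lemma half: "x / 2 = x * h" "2 * h = 1"
  by (simp_all add: h)

text \<open>One name for all arrangements of the total degree makes equal basis indices
  syntactically equal. The shift by 1 comes from \<open>[Y, Y]\<close>.\<close>

lemma degree_sums:
  "a + (b + c) = s" "b + (c + a) = s" "c + (a + b) = s" "b + (a + c) = s"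
  "a + (c + b) = s" "c + (b + a) = s" "a + b + c = s" "b + c + a = s" "c + a + b = s"
  "b + a + c = s" "a + c + b = s" "c + b + a = s"
  "a + (b + c + 1) = s + 1" "a + c + b + 1 = s + 1" "a + b + c + 1 = s + 1"
  by (auto simp: s)

text \<open>Central terms occur only in total degree 0, and there the relation between the degrees
  makes them cancel.\<close>

lemma delta0_degree_cases:
  obtains "delta0 s = 0" | "delta0 s = 1" "of_int a + of_int b + of_int c = (0 :: complex)"
  unfolding s by (cases "a + b + c = 0") (auto simp: delta0_def simp flip: of_int_add)

text \<open>These are the 20 multisets of three families, sorted in the order L, N, M, Y. Each
  coefficient is a polynomial identity in the degrees.\<close>

lemma jacobiator_sorted:
  "jacobiator (L a) (L b) (L c) = 0" "jacobiator (L a) (L b) (N c) = 0"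
  "jacobiator (L a) (L b) (M c) = 0" "jacobiator (L a) (L b) (Y c) = 0"
  "jacobiator (L a) (N b) (N c) = 0" "jacobiator (L a) (N b) (M c) = 0"
  "jacobiator (L a) (N b) (Y c) = 0" "jacobiator (L a) (M b) (M c) = 0"
  "jacobiator (L a) (M b) (Y c) = 0" "jacobiator (L a) (Y b) (Y c) = 0"
  "jacobiator (N a) (N b) (N c) = 0" "jacobiator (N a) (N b) (M c) = 0"
  "jacobiator (N a) (N b) (Y c) = 0" "jacobiator (N a) (M b) (M c) = 0"
  "jacobiator (N a) (M b) (Y c) = 0" "jacobiator (N a) (Y b) (Y c) = 0"
  "jacobiator (M a) (M b) (M c) = 0" "jacobiator (M a) (M b) (Y c) = 0"
  "jacobiator (M a) (Y b) (Y c) = 0" "jacobiator (Y a) (Y b) (Y c) = 0"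
  by (rule poly_mapping_eqI, rule delta0_degree_cases;
    simp add: jacobiator_def degree_sums lookup_add lookup_minus lookup_single when_def
      flip: add_divide_distrib;
    (intro conjI drop_premise)?; (thin_tac "delta0 s = _")?;
    (algebra | (thin_tac "_ = 0", algebra) |
      ((thin_tac "_ = 0")?, simp only: half(1), (algebra | (insert half(2), algebra))))?)+

end

lemma jacobiator_cyclic: "jacobiator i j k = 0 \<Longrightarrow> jacobiator j k i = 0"
  unfolding jacobiator_def by (simp only: add.commute add.left_commute)

text \<open>By antisymmetry of the inner brackets, a transposition negates the sum.\<close>

lemma jacobiator_swap:
  assumes "jacobiator i j k = 0"
  shows "jacobiator j i k = 0"
proof -
  have "jacobiator j i k = - jacobiator i j k"
    unfolding jacobiator_def
    by (subst (1 2 3) sv_hat_basis_bracket_antisym) simp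
  then show ?thesis
    using assms by simp
qed

text \<open>Cyclic shifts and a transposition reach all six orders of a sorted triple.\<close>

lemma jacobiator_eq_0: "jacobiator i j k = 0"
proof -
  note sorted = jacobiator_sorted[OF refl refl]
  note cyclic = sorted[THEN jacobiator_cyclic] sorted[THEN jacobiator_cyclic, THEN jacobiator_cyclic]
  show ?thesis
    by (cases i; cases j; cases k)
      (simp_all only: sorted cyclic sorted[THEN jacobiator_swap] cyclic[THEN jacobiator_swap])
qed

lemma lie_algebra_sv_hat: "lie_algebra pscale sv_hat_bracket"
  unfolding sv_hat_bracket_def
proof (rule lie_algebra_bilinear_extension)
  fix i j k
  show "linear_extension pscale (sv_hat_basis_bracket i) (sv_hat_basis_bracket j k) +
    linear_extension pscale (sv_hat_basis_bracket j) (sv_hat_basis_bracket k i) +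
    linear_extension pscale (sv_hat_basis_bracket k) (sv_hat_basis_bracket i j) = 0"
    using jacobiator_eq_0 unfolding jacobiator_def
    by (cases i; cases j; cases k; simp)
qed (rule sv_hat_basis_bracket_antisym)

section \<open>Cocycles of the extended algebra\<close>

interpretation scalars: vector_space "(*) :: 'k::field \<Rightarrow> 'k \<Rightarrow> 'k"
  by unfold_locales (simp_all add: algebra_simps)

text \<open>
  Each basis vector of the covering algebra is a multiple of a bracket of two basis vectors, up to
  vectors that precede it. A cocycle therefore has only one candidate for its factorization.
\<close>

fun cocycle_lift ::
  "('k::field \<Rightarrow> 'v::ab_group_add \<Rightarrow> 'v) \<Rightarrow> (sv_index \<Rightarrow> sv_index \<Rightarrow> 'v) \<Rightarrow> sv_hat_index \<Rightarrow> 'v" where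
  "cocycle_lift s \<beta> (Lift (L n)) =
     (if n = 0 then s (1 / 2) (\<beta> (L (- 1)) (L 1)) else s (1 / of_int n) (\<beta> (L 0) (L n)))"
| "cocycle_lift s \<beta> (Lift (M n)) = s (1 / 2) (\<beta> (N 0) (M n))"
| "cocycle_lift s \<beta> (Lift (N n)) =
     (if n = 0 then - \<beta> (L 1) (N (- 1)) else s (1 / of_int n) (\<beta> (L 0) (N n)))"
| "cocycle_lift s \<beta> (Lift (Y n)) = \<beta> (N 0) (Y n)"
| "cocycle_lift s \<beta> C_L = s 2 (\<beta> (L 2) (L (- 2))) + s 4 (\<beta> (L (- 1)) (L 1))"
| "cocycle_lift s \<beta> C_LN = s (1 / 2) (\<beta> (L (- 1)) (N 1) + \<beta> (L 1) (N (- 1)))"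
| "cocycle_lift s \<beta> C_N = \<beta> (N (- 1)) (N 1)"

text \<open>The inductions start at 2 and -2 because the leading coefficients of the recursions
  below vanish closer to 0.\<close>

lemma int_function_eq_0:
  fixes g :: "int \<Rightarrow> 'a::zero"
  assumes "\<And>m. \<bar>m\<bar> \<le> 2 \<Longrightarrow> g m = 0"
    and up: "\<And>m. m \<ge> 2 \<Longrightarrow> g m = 0 \<Longrightarrow> g (m + 1) = 0"
    and down: "\<And>m. m \<le> - 2 \<Longrightarrow> g m = 0 \<Longrightarrow> g (m - 1) = 0"
  shows "g m = 0"
proof -
  have "g m = 0" if "m \<ge> 2" for m
    using that by (induction m rule: int_ge_induct) (auto simp: assms(1) up)
  moreover have "g m = 0" if "m \<le> - 2" for m
    using that by (induction m rule: int_le_induct) (auto simp: assms(1) down)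
  ultimately show ?thesis
    using assms(1)[of m] by (cases "m \<ge> 2"; cases "m \<le> - 2") auto
qed

section \<open>Scalar cocycles, beginning with the antidiagonal\<close>

context
  fixes \<beta> :: "sv_index \<Rightarrow> sv_index \<Rightarrow> complex"
  assumes anti: "\<And>i j. \<beta> i j = - \<beta> j i"
    and cocycle: "\<And>i j k. linear_extension (*) (\<beta> i) (sv_basis_bracket j k) +
      linear_extension (*) (\<beta> j) (sv_basis_bracket k i) +
      linear_extension (*) (\<beta> k) (sv_basis_bracket i j) = 0"
begin

text \<open>This is the classical cocycle computation for the Witt algebra: the recursion is solved
  by combinations of \<open>m\<close> and \<open>m ^ 3\<close>.\<close>

lemma cocycle_LL_anti_diagonal:
  "\<beta> (L m) (L (- m)) = - of_int m * \<beta> (L (- 1)) (L 1) +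
     (of_int m ^ 3 - of_int m) / 6 * (\<beta> (L 2) (L (- 2)) + 2 * \<beta> (L (- 1)) (L 1))"
proof -
  define f where "f m = \<beta> (L m) (L (- m))" for m
  \<comment> \<open>The constants are fitted so that \<open>p\<close> agrees with \<open>f\<close>
    at 1 and 2.\<close>
  define c where "c = (f 2 + 2 * f (- 1)) / 6"
  define p where "p m = (of_int m ^ 3 - of_int m) * c - of_int m * f (- 1)" for m
  define g where "g m = f m - p m" for m
  have f: "f (- m) = - f m" for m
    using anti[of "L m" "L (- m)"] by (simp add: f_def)
  have p: "p (- m) = - p m" for m
    by (simp add: p_def algebra_simps)
  have g: "g (- m) = - g m" for m
    by (simp add: g_def f p)
  have rec0: "of_int (c - b) * f a + of_int (a - c) * f b + of_int (b - a) * f c = 0"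
    if "a + b + c = 0" for a b c
  proof -
    have eqs: "b + c = - a" "c + a = - b" "a + b = - c"
      using that by auto
    show ?thesis
      using cocycle[of "L a" "L b" "L c"] by (simp add: f_def eqs)
  qed
  have rec: "of_int (m - 1) * f (m + 1) = of_int (m + 2) * f m - of_int (2 * m + 1) * f 1" for m
    using rec0[of 1 m "- (m + 1)"]
    by (simp only: f of_int_diff of_int_add of_int_mult of_int_minus of_int_1 of_int_numeral) algebra
  have prec: "of_int (m - 1) * p (m + 1) = of_int (m + 2) * p m - of_int (2 * m + 1) * p 1" for m
    unfolding p_def
    by (simp only: of_int_diff of_int_add of_int_mult of_int_1 of_int_numeral power_one) algebra
  have "g 1 = 0"
    using f[of 1] by (simp add: g_def p_def)
  then have grec: "of_int (m - 1) * g (m + 1) = of_int (m + 2) * g m" for m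
    unfolding g_def right_diff_distrib rec prec by simp
  have "f 0 = 0"
    using f[of 0] by simp
  have "g m = 0"
  proof (rule int_function_eq_0)
    fix m :: int
    assume "\<bar>m\<bar> \<le> 2"
    then have "m \<in> {-2, -1, 0, 1, 2}" by auto
    then show "g m = 0"
      using f[of 1] f[of 2] \<open>f 0 = 0\<close>
      by (auto simp: g_def p_def c_def diff_divide_distrib add_divide_distrib)
  next
    fix m :: int
    assume "m \<ge> 2" "g m = 0"
    then show "g (m + 1) = 0" using grec[of m] by auto
  next
    fix m :: int
    assume "m \<le> - 2" "g m = 0"
    \<comment> \<open>Oddness of \<open>g\<close> turns the upward step at \<open>- m\<close> into
      the downward step at \<open>m\<close>.\<close>
    then show "g (m - 1) = 0"
      using grec[of "- m"] g[of m] g[of "m - 1"]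
      by (auto simp flip: of_int_minus of_int_diff of_int_add)
  qed
  then show ?thesis
    by (simp add: g_def p_def c_def f_def)
qed

text \<open>Here the solutions are spanned by \<open>m\<close> and \<open>m ^ 2\<close>. They have
  no common parity, so the values at 1 and -1 are both parameters.\<close>

lemma cocycle_LN_anti_diagonal:
  "\<beta> (L m) (N (- m)) = of_int m * \<beta> (L 1) (N (- 1)) +
     (of_int m ^ 2 - of_int m) / 2 * (\<beta> (L (- 1)) (N 1) + \<beta> (L 1) (N (- 1)))"
proof -
  define h where "h m = \<beta> (L m) (N (- m))" for m
  define c where "c = (h (- 1) + h 1) / 2"
  define p where "p m = of_int m * h 1 + (of_int m ^ 2 - of_int m) * c" for m
  define g where "g m = h m - p m" for m
  have rec: "of_int (a + b) * (h b - h a) = of_int (b - a) * h (a + b)" for a b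
  proof -
    define c where "c = - (a + b)"
    have eqs: "b + c = - a" "a + c = - b" "of_int a + of_int b = - (of_int c :: complex)"
      by (auto simp: c_def)
    have hab: "h (a + b) = \<beta> (L (a + b)) (N c)"
      by (simp add: h_def c_def)
    show ?thesis
      using cocycle[of "L a" "L b" "N c"] anti[of "N c" "L (a + b)"]
      unfolding hab by (simp add: h_def eqs right_diff_distrib left_diff_distrib) algebra
  qed
  have prec: "of_int (a + b) * (p b - p a) = of_int (b - a) * p (a + b)" for a b
    unfolding p_def
    by (simp only: of_int_diff of_int_add of_int_mult of_int_1 of_int_numeral power_one) algebra
  have "of_int (a + b) * (g b - g a) =
      of_int (a + b) * (h b - h a) - of_int (a + b) * (p b - p a)" for a b
    by (simp add: g_def algebra_simps)
  then have grec: "of_int (a + b) * (g b - g a) = of_int (b - a) * g (a + b)" for a b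
    unfolding rec prec by (simp add: g_def right_diff_distrib)
  have "h 0 = 0"
    using rec[of 1 0] by simp
  then have g0: "g 0 = 0" "g 1 = 0" "g (- 1) = 0"
    by (auto simp: g_def p_def c_def diff_divide_distrib add_divide_distrib)
  \<comment> \<open>The degree sums \<open>-1 + 2 = 1\<close> and \<open>1 - 2 = -1\<close> lead
    back to the known values.\<close>
  have g2: "g 2 = 0" "g (- 2) = 0"
    using grec[of "- 1" 2] grec[of 1 "- 2"] g0 by auto
  have "g m = 0"
  proof (rule int_function_eq_0)
    fix m :: int
    assume "\<bar>m\<bar> \<le> 2"
    then have "m \<in> {-2, -1, 0, 1, 2}" by auto
    then show "g m = 0"
      using g0 g2 by auto
  next
    fix m :: int
    assume "m \<ge> 2" "g m = 0"
    then show "g (m + 1) = 0" using grec[of 1 m] g0 by (auto simp: add.commute)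
  next
    fix m :: int
    assume "m \<le> - 2" "g m = 0"
    have "of_int (m + 1) * g (m - 1) = 0"
      using grec[of "- 1" m] g0 \<open>g m = 0\<close> by (simp add: add.commute)
    then show "g (m - 1) = 0"
      using \<open>m \<le> - 2\<close> by (simp only: mult_eq_0_iff of_int_eq_0_iff) auto
  qed
  then show ?thesis
    by (simp add: g_def p_def c_def h_def)
qed

text \<open>Since \<open>N m\<close> and \<open>N 1\<close> commute, one instance of the identity
  compares the two values directly.\<close>

lemma cocycle_NN_anti_diagonal: "\<beta> (N m) (N (- m)) = of_int m * \<beta> (N 1) (N (- 1))"
proof -
  have "- (1 + m) + m = - 1" "1 + - (1 + m) = - m"
    by auto
  then show ?thesis
    using cocycle[of "L (- (1 + m))" "N m" "N 1"] by simp
qed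

text \<open>
  \<open>N 0\<close> acts diagonally, so the cocycle identity with \<open>N 0\<close> determines the values on pairs of
  nonzero total weight; \<open>L 0\<close> does the same for the remaining pairs off the antidiagonal.
\<close>

lemma cocycle_eq:
  "\<beta> i j = linear_extension (*) (cocycle_lift (*) \<beta>) (sv_hat_basis_bracket (Lift i) (Lift j))"
proof -
  let ?P = "\<lambda>i j. \<beta> i j =
    linear_extension (*) (cocycle_lift (*) \<beta>) (sv_hat_basis_bracket (Lift i) (Lift j))"
  have flip: "?P j i" if "?P i j" for i j
    using that anti[of i j] sv_hat_basis_bracket_antisym[of "Lift i" "Lift j"] by simp
  have LL: "?P (L m) (L n)" for m n
  proof (cases "m + n = 0")
    case True
    \<comment> \<open>The two terms come from \<open>L 0\<close> with coefficient
      \<open>- 2 * m\<close> and from \<open>C_L\<close> with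
      \<open>(m ^ 3 - m) / 12\<close>.\<close>
    have "?P (L m) (L (- m))"
      unfolding cocycle_LL_anti_diagonal[of m] by simp algebra
    then show ?thesis
      using True by (simp only: add_eq_0_iff)
  next
    case False
    have nz: "of_int m + of_int n \<noteq> (0 :: complex)"
      using False by (metis of_int_add of_int_eq_0_iff)
    \<comment> \<open>The identity with \<open>L 0\<close> reads \<open>(m + n) * \<beta> (L m) (L
      n) = (n - m) * \<beta> (L 0) (L (m + n))\<close>.\<close>
    show ?thesis
      using cocycle[of "L 0" "L m" "L n"] anti[of "L n" "L m"]
      by (simp add: nonzero_eq_divide_eq nz False) algebra
  qed
  have LN: "?P (L m) (N n)" for m n
  proof (cases "m + n = 0")
    case True
    have "?P (L m) (N (- m))"
      unfolding cocycle_LN_anti_diagonal[of m] by simp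
    then show ?thesis
      using True by (simp only: add_eq_0_iff)
  next
    case False
    have nz: "of_int m + of_int n \<noteq> (0 :: complex)"
      using False by (metis of_int_add of_int_eq_0_iff)
    show ?thesis
      using cocycle[of "L 0" "L m" "N n"] anti[of "N n" "L m"]
      by (simp add: nonzero_eq_divide_eq nz False) algebra
  qed
  have NN: "?P (N m) (N n)" for m n
  proof (cases "m + n = 0")
    case True
    have "?P (N m) (N (- m))"
      unfolding cocycle_NN_anti_diagonal[of m] using anti[of "N 1" "N (- 1)"] by simp
    then show ?thesis
      using True by (simp only: add_eq_0_iff)
  next
    case False
    have "of_int (m + n) * \<beta> (N m) (N n) = 0"
      using cocycle[of "L 0" "N m" "N n"] anti[of "N n" "N m"]
      by simp algebra
    then show ?thesis
      using False by (simp only: mult_eq_0_iff of_int_eq_0_iff) simp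
  qed
  \<comment> \<open>The weights of \<open>N 0\<close> are 0 on L and N, 1 on Y and 2 on M, so each
    pair below has total weight between 1 and 4.\<close>
  have LM: "?P (L m) (M n)" for m n
    using cocycle[of "N 0" "L m" "M n"] anti[of "M n" "L m"] by simp
  have LY: "?P (L m) (Y n)" for m n
    using cocycle[of "N 0" "L m" "Y n"] anti[of "Y n" "L m"] by simp
  have NM: "?P (N m) (M n)" for m n
    using cocycle[of "N 0" "N m" "M n"] anti[of "M n" "N m"] by simp
  have NY: "?P (N m) (Y n)" for m n
    using cocycle[of "N 0" "N m" "Y n"] anti[of "Y n" "N m"] by simp
  have MM: "?P (M m) (M n)" for m n
    using cocycle[of "N 0" "M m" "M n"] anti[of "M n" "M m"] by simp
  have MY: "?P (M m) (Y n)" for m n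
    using cocycle[of "N 0" "M m" "Y n"] anti[of "Y n" "M m"] by simp
  have YY: "?P (Y m) (Y n)" for m n
    using cocycle[of "N 0" "Y m" "Y n"] anti[of "Y n" "Y m"] by simp
  show ?thesis
    by (cases i; cases j)
      (simp_all only: LL LN NN LM LY NM NY MM MY YY
        flip[OF LN] flip[OF LM] flip[OF LY] flip[OF NM] flip[OF NY] flip[OF MY])
qed

end

section \<open>The covering\<close>

text \<open>\<open>map_key\<close> composes with the key map only if that map is injective and is
  zero otherwise; \<open>Lift\<close> is injective.\<close>

lemma lookup_sv_projection [simp]:
  "Poly_Mapping.lookup (sv_projection f) i = Poly_Mapping.lookup f (Lift i)"
  by (simp add: sv_projection_def map_key.rep_eq inj_def)

lemma sv_projection_single [simp]:
  "sv_projection (Poly_Mapping.single (Lift i) c) = Poly_Mapping.single i c"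
  "sv_projection (Poly_Mapping.single C_L c) = 0"
  "sv_projection (Poly_Mapping.single C_LN c) = 0"
  "sv_projection (Poly_Mapping.single C_N c) = 0"
  by (rule poly_mapping_eqI; simp add: lookup_single when_def)+

lemma sv_projection_add [simp]: "sv_projection (f + g) = sv_projection f + sv_projection g"
  by (rule poly_mapping_eqI) (simp add: lookup_add)

lemma sv_projection_uminus [simp]: "sv_projection (- f) = - sv_projection f"
  by (rule poly_mapping_eqI) simp

lemma sv_projection_diff [simp]: "sv_projection (f - g) = sv_projection f - sv_projection g"
  by (rule poly_mapping_eqI) (simp add: lookup_minus)

lemma sv_projection_zero [simp]: "sv_projection 0 = 0"
  by (rule poly_mapping_eqI) simp

lemma linear_sv_projection: "Vector_Spaces.linear pscale pscale sv_projection"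
  unfolding Vector_Spaces.linear_iff
  by (auto intro!: pscale.vector_space_axioms poly_mapping_eqI)

lemma surj_sv_projection: "surj sv_projection"
proof (rule surjI)
  fix g :: sv
  let ?s = "linear_extension pscale (\<lambda>i. Poly_Mapping.single (Lift i) (1 :: complex))"
  have "Vector_Spaces.linear pscale pscale (sv_projection \<circ> ?s)"
    by (rule Vector_Spaces.linear_compose[OF pscale.linear_linear_extension linear_sv_projection])
  from linear_eq_on_basis[OF this pscale.linear_id, of g] show "sv_projection (?s g) = g"
    by simp
qed

text \<open>On basis vectors the two brackets differ only by central terms, which the projection
  kills.\<close>

lemma sv_projection_bracket:
  "sv_projection (sv_hat_bracket x y) = sv_bracket (sv_projection x) (sv_projection y)"
proof -
  note lin = bilinear_extension_linear_left bilinear_extension_linear_right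
  note comp = Vector_Spaces.linear_compose[unfolded o_def]
  have basis: "sv_projection (sv_hat_basis_bracket i j) =
      sv_bracket (sv_projection (Poly_Mapping.single i 1)) (sv_projection (Poly_Mapping.single j 1))"
    for i j
    by (cases "(i, j)" rule: sv_hat_basis_bracket.cases)
      (auto simp: sv_bracket_def bilinear_extension_eq_left single_uminus)
  show ?thesis
    by (rule bilinear_eq_on_basis[where s = pscale and f = "\<lambda>x y. sv_projection (sv_hat_bracket x y)"
          and g = "\<lambda>x y. sv_bracket (sv_projection x) (sv_projection y)"])
      (use basis in \<open>auto simp: sv_hat_bracket_def sv_bracket_def
        intro: comp[OF lin(1) linear_sv_projection] comp[OF lin(2) linear_sv_projection]
          comp[OF linear_sv_projection lin(1)] comp[OF linear_sv_projection lin(2)]\<close>)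
qed

text \<open>The support of such an \<open>x\<close> contains only central indices.\<close>

lemma sv_hat_bracket_eq_0:
  assumes "sv_projection x = 0"
  shows "sv_hat_bracket x y = 0"
proof -
  have "Poly_Mapping.lookup x (Lift i) = 0" for i
    using assms by (metis lookup_sv_projection lookup_zero)
  then have "sv_hat_basis_bracket i = (\<lambda>_. 0)" if "i \<in> Poly_Mapping.keys x" for i
    using that by (cases i) (auto simp: in_keys_iff)
  then show ?thesis
    unfolding sv_hat_bracket_def bilinear_extension_eq_left
    by (subst linear_extension_def) simp
qed

text \<open>The identities descend along the surjective projection, which respects brackets.\<close>

lemma lie_algebra_sv: "lie_algebra pscale sv_bracket"
proof -
  interpret hat: lie_algebra pscale sv_hat_bracket by (rule lie_algebra_sv_hat)
  have preimage: "\<exists>u. x = sv_projection u" for x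
    using surj_sv_projection by blast
  show ?thesis
  proof (rule lie_algebra.intro[OF pscale.vector_space_axioms lie_algebra_axioms.intro])
    fix x y z
    obtain u v w where uvw: "x = sv_projection u" "y = sv_projection v" "z = sv_projection w"
      using preimage by metis
    show "sv_bracket x x = 0"
      unfolding uvw sv_projection_bracket[symmetric] by (simp add: hat.alternating)
    show "sv_bracket x (sv_bracket y z) + sv_bracket y (sv_bracket z x) +
        sv_bracket z (sv_bracket x y) = 0"
      unfolding uvw sv_projection_bracket[symmetric] sv_projection_add[symmetric] hat.jacobi
      by simp
  qed (simp_all only: sv_bracket_def bilinear_extension_linear_left bilinear_extension_linear_right)
qed

section \<open>Perfectness of the covering algebra\<close>

lemma perfect_sv_hat: "perfect_lie_algebra pscale sv_hat_bracket"
proof -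
  interpret lie_algebra pscale sv_hat_bracket by (rule lie_algebra_sv_hat)
  let ?e = "\<lambda>i. Poly_Mapping.single i (1 :: complex)"
  have sub: "pscale.subspace derived"
    unfolding derived_def by (rule pscale.subspace_span)
  have "sv_hat_bracket (?e i) (?e j) \<in> derived" for i j
    unfolding derived_def by (rule pscale.span_base) blast
  then have br: "sv_hat_basis_bracket i j \<in> derived" for i j
    by (simp add: sv_hat_bracket_def)
  have scaled: "?e i \<in> derived" if "Poly_Mapping.single i c \<in> derived" "c \<noteq> 0" for i c
    using pscale.subspace_scale[OF sub that(1), of "1 / c"] that(2) by simp
  have central: "Poly_Mapping.single i c \<in> derived"
    if "x + Poly_Mapping.single i c \<in> derived" "x \<in> derived" for i c x
    using pscale.subspace_diff[OF sub that] by simp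
  have multiple: "Poly_Mapping.single i c \<in> derived" if "?e i \<in> derived" for i c
    using pscale.subspace_scale[OF sub that, of c] by simp
  have M: "?e (Lift (M n)) \<in> derived" for n
    using br[of "Lift (N 0)" "Lift (M n)"] by (auto intro: scaled)
  have Y: "?e (Lift (Y n)) \<in> derived" for n
    using br[of "Lift (N 0)" "Lift (Y n)"] by (auto intro: scaled)
  have L: "?e (Lift (L n)) \<in> derived" for n
  proof (cases "n = 0")
    case True
    then show ?thesis
      using br[of "Lift (L (- 1))" "Lift (L 1)"] by (auto intro: scaled)
  next
    case False
    then show ?thesis
      using br[of "Lift (L 0)" "Lift (L n)"] by (auto intro: scaled)
  qed
  \<comment> \<open>\<open>N 0\<close> arises from \<open>[L 1, N (- 1)]\<close>, where the
    coefficient \<open>m ^ 2 - m\<close> of \<open>C_LN\<close> is zero.\<close>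
  have N: "?e (Lift (N n)) \<in> derived" for n
  proof (cases "n = 0")
    case True
    then show ?thesis
      using br[of "Lift (L 1)" "Lift (N (- 1))"] by (auto intro: scaled)
  next
    case False
    then show ?thesis
      using br[of "Lift (L 0)" "Lift (N n)"] by (auto intro: scaled)
  qed
  \<comment> \<open>\<open>[L 2, L (- 2)]\<close> equals \<open>- 4 L 0 + C_L / 2\<close>.\<close>
  have "Poly_Mapping.single C_L (1 / 2) \<in> derived"
    using br[of "Lift (L 2)" "Lift (L (- 2))"]
    by (intro central[OF _ multiple[OF L[of 0], of "- 4"]]) simp
  then have C_L: "?e C_L \<in> derived"
    by (rule scaled) simp
  \<comment> \<open>\<open>[L (- 1), N 1]\<close> equals \<open>N 0 + 2 C_LN\<close>.\<close>
  have "Poly_Mapping.single C_LN 2 \<in> derived"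
    using br[of "Lift (L (- 1))" "Lift (N 1)"]
    by (intro central[OF _ N[of 0]]) simp
  then have C_LN: "?e C_LN \<in> derived"
    by (rule scaled) simp
  have C_N: "?e C_N \<in> derived"
    using br[of "Lift (N (- 1))" "Lift (N 1)"] by simp
  have e: "?e i \<in> derived" for i
  proof (cases i)
    case (Lift j)
    then show ?thesis
      using L M N Y by (cases j) simp_all
  qed (simp_all add: C_L C_LN C_N)
  have "x \<in> derived" for x
    by (subst poly_mapping_expansion)
      (intro pscale.subspace_sum[OF sub] pscale.subspace_scale[OF sub] e)
  then show ?thesis
    by unfold_locales auto
qed

lemma lie_hom_sv_projection: "lie_hom pscale sv_hat_bracket pscale sv_bracket sv_projection"
  by (intro lie_hom.intro lie_hom_axioms.intro lie_algebra_sv_hat lie_algebra_sv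
      linear_sv_projection sv_projection_bracket)

lemma covering_sv_projection: "covering pscale sv_hat_bracket pscale sv_bracket sv_projection"
proof -
  interpret hat: perfect_lie_algebra pscale sv_hat_bracket by (rule perfect_sv_hat)
  interpret lie_hom pscale sv_hat_bracket pscale sv_bracket sv_projection
    by (rule lie_hom_sv_projection)
  have "perfect_lie_algebra pscale sv_bracket"
    using perfect_image[OF hat.perfect surj_sv_projection] by unfold_locales
  moreover have "{x. sv_projection x = 0} \<subseteq> hat.center"
    using sv_hat_bracket_eq_0 by (auto simp: hat.center_def)
  ultimately show ?thesis
    by (intro covering.intro central_extension.intro central_extension_axioms.intro
        lie_hom_sv_projection perfect_sv_hat surj_sv_projection)
qed

section \<open>The universal property\<close>

context
  fixes s :: "complex \<Rightarrow> 'v::ab_group_add \<Rightarrow> 'v" and B :: "sv \<Rightarrow> sv \<Rightarrow> 'v" and \<beta>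
  assumes lin: "\<And>y. Vector_Spaces.linear pscale s (\<lambda>x. B x y)"
    and anti: "\<And>x y. B x y = - B y x"
    and cocycle: "\<And>x y z. B x (sv_bracket y z) + B y (sv_bracket z x) + B z (sv_bracket x y) = 0"
  defines "\<beta> \<equiv> \<lambda>i j. B (Poly_Mapping.single i 1) (Poly_Mapping.single j 1)"
begin

interpretation target: vector_space s
  using lin[of 0] by (simp add: Vector_Spaces.linear_iff)

lemma cocycle_linear_right: "Vector_Spaces.linear pscale s (B x)"
proof -
  have "Vector_Spaces.linear pscale s (\<lambda>y. - B y x)"
    using lin[of x] by (simp add: Vector_Spaces.linear_iff)
  then show ?thesis
    by (simp only: anti[symmetric])
qed

text \<open>Testing the claim with linear functionals reduces it to the case of scalar cocycles.\<close>

lemma cocycle_basis: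
  "\<beta> u v = linear_extension s (cocycle_lift s \<beta>) (sv_hat_basis_bracket (Lift u) (Lift v))"
    (is "_ = ?R")
proof (rule ccontr)
  assume "\<beta> u v \<noteq> ?R"
  then have "\<beta> u v - ?R \<noteq> 0"
    by simp
  then obtain f where f: "Vector_Spaces.linear s (*) f" "f (\<beta> u v - ?R) \<noteq> 0"
    by (rule target.separating_functional)
  interpret f: Vector_Spaces.linear s "(*)" f by (rule f(1))
  have ext: "linear_extension (*) (\<lambda>j. f (\<beta> i j)) g = f (B (Poly_Mapping.single i 1) g)" for i g
    unfolding linear_eq_linear_extension[OF cocycle_linear_right, of _ g]
    by (simp add: linear_comp_linear_extension[OF f(1)] \<beta>_def)
  have bb: "sv_basis_bracket i j = sv_bracket (Poly_Mapping.single i 1) (Poly_Mapping.single j 1)"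
    for i j
    by (simp add: sv_bracket_def)
  have "f (\<beta> u v) =
      linear_extension (*) (cocycle_lift (*) (\<lambda>i j. f (\<beta> i j))) (sv_hat_basis_bracket (Lift u) (Lift v))"
  proof (rule cocycle_eq)
    show "f (\<beta> i j) = - f (\<beta> j i)" for i j
      unfolding f.neg[symmetric] \<beta>_def by (rule arg_cong[OF anti])
    show "linear_extension (*) (\<lambda>a. f (\<beta> i a)) (sv_basis_bracket j k) +
      linear_extension (*) (\<lambda>a. f (\<beta> j a)) (sv_basis_bracket k i) +
      linear_extension (*) (\<lambda>a. f (\<beta> k a)) (sv_basis_bracket i j) = 0" for i j k
      unfolding ext bb f.add[symmetric] cocycle by (rule f.zero)
  qed
  \<comment> \<open>\<open>cocycle_lift\<close> forms only linear combinations of values of the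
    cocycle, so it commutes with \<open>f\<close>.\<close>
  also have "cocycle_lift (*) (\<lambda>i j. f (\<beta> i j)) k = f (cocycle_lift s \<beta> k)" for k
    by (cases "(s, \<beta>, k)" rule: cocycle_lift.cases) (simp_all add: f.add f.scale f.neg)
  then have "cocycle_lift (*) (\<lambda>i j. f (\<beta> i j)) = (\<lambda>k. f (cocycle_lift s \<beta> k))"
    by blast
  also have "linear_extension (*) (\<lambda>k. f (cocycle_lift s \<beta> k))
      (sv_hat_basis_bracket (Lift u) (Lift v)) = f ?R"
    by (rule linear_comp_linear_extension[OF f(1), symmetric])
  finally show False
    using f(2) by (simp add: f.diff)
qed

text \<open>Both sides are bilinear and vanish on central basis vectors, so only pairs of lifted
  indices remain.\<close>

lemma cocycle_factorization:
  "B (sv_projection x) (sv_projection y) =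
    linear_extension s (cocycle_lift s \<beta>) (sv_hat_bracket x y)"
proof -
  note comp = Vector_Spaces.linear_compose[unfolded o_def]
  note lin' = bilinear_extension_linear_left bilinear_extension_linear_right
  have zero: "B 0 z = 0" "B z 0 = 0" for z
  proof -
    interpret l: Vector_Spaces.linear pscale s "\<lambda>x. B x z" by (rule lin)
    interpret r: Vector_Spaces.linear pscale s "B z" by (rule cocycle_linear_right)
    show "B 0 z = 0" "B z 0 = 0"
      by (rule l.zero, rule r.zero)
  qed
  have basis: "B (sv_projection (Poly_Mapping.single i 1)) (sv_projection (Poly_Mapping.single j 1)) =
      linear_extension s (cocycle_lift s \<beta>) (sv_hat_basis_bracket i j)" for i j
  proof (cases i; cases j)
    fix u v
    assume "i = Lift u" "j = Lift v"
    then show ?thesis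
      using cocycle_basis[of u v] by (simp add: \<beta>_def)
  qed (simp_all add: zero)
  show ?thesis
    by (rule bilinear_eq_on_basis[where s = s and f = "\<lambda>x y. B (sv_projection x) (sv_projection y)"
          and g = "\<lambda>x y. linear_extension s (cocycle_lift s \<beta>) (sv_hat_bracket x y)"])
      (use basis in \<open>auto simp: sv_hat_bracket_def
        intro: comp[OF lin'(1) target.linear_linear_extension]
          comp[OF lin'(2) target.linear_linear_extension]
          comp[OF linear_sv_projection lin] comp[OF linear_sv_projection cocycle_linear_right]\<close>)
qed

end

theorem corollary3p3:
  shows "universal_central_extension TYPE('c::ab_group_add)
           pscale sv_hat_bracket pscale sv_bracket sv_projection"
  unfolding universal_central_extension_def
proof (intro conjI allI impI covering_sv_projection)
  fix s :: "complex \<Rightarrow> 'c \<Rightarrow> 'c" and b \<phi>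
  assume ext: "central_extension s b pscale sv_bracket \<phi>"
  interpret central_extension s b pscale sv_bracket \<phi> by (rule ext)
  \<comment> \<open>The values of \<open>cocycle_lift\<close> on the lifted bracket prescribe the
    map on the basis.\<close>
  let ?\<psi> = "linear_extension s (cocycle_lift s
    (\<lambda>i j. lifted_bracket (Poly_Mapping.single i 1) (Poly_Mapping.single j 1)))"
  have "lifted_bracket (sv_projection x) (sv_projection y) = ?\<psi> (sv_hat_bracket x y)" for x y
    by (rule cocycle_factorization[OF lifted_bracket_linear_left lifted_bracket_antisym
          lifted_bracket_cocycle])
  then have ex: "lie_hom pscale sv_hat_bracket s b ?\<psi> \<and> \<phi> \<circ> ?\<psi> = sv_projection"
    by (rule lie_hom_of_factored_bracket[OF perfect_sv_hat lie_hom_sv_projection ext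
          dom.linear_linear_extension])
  have unique: "\<psi> = \<chi>"
    if "lie_hom pscale sv_hat_bracket s b \<psi> \<and> \<phi> \<circ> \<psi> = sv_projection"
      "lie_hom pscale sv_hat_bracket s b \<chi> \<and> \<phi> \<circ> \<chi> = sv_projection" for \<psi> \<chi>
    using that by (intro lie_hom_into_central_extension_unique[OF perfect_sv_hat ext]) simp_all
  show "\<exists>!\<psi>. lie_hom pscale sv_hat_bracket s b \<psi> \<and> \<phi> \<circ> \<psi> = sv_projection"
    by (rule ex1I, rule ex) (rule unique[OF _ ex])
qed

end
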